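(* Let $F$ be a field of characteristic $0$ and let $q_1q_2\cdots q_n$ be a sequence over $\{{\tt A},{\tt S},{\tt N}\}$. Then there exists a symmetric matrix $B\in F^{n\times n}$ with $\operatorname{qpr}(B)=q_1q_2\cdots q_n$ if and only if: (i) $q_n \neq {\tt S}$; and (ii) neither ${\tt NA}$ nor ${\tt NS}$ occurs as a subsequence (pair of consecutive terms) of $q_1q_2 \cdots q_n$.
   Context: For an $n\times n$ matrix $B$ and $\alpha,\beta\subseteq\{1,\dots,n\}$, $B[\alpha,\beta]$ denotes the submatrix with rows indexed by $\alpha$ and columns indexed by $\beta$. $B[\alpha,\beta]$ is a quasi-principal submatrix if $|\alpha|=|\beta|$ and $|\alpha|-1\le|\alpha\cap\beta|\le|\alpha|$; its determinant is then a quasi-principal minor of order $|\alpha|$ (quasi-principal minors are exactly the principal and almost-principal minors). The quasi principal rank characteristic sequence of a symmetric $B\in F^{n\times n}$ is $\operatorname{qpr}(B)=q_1q_2\cdots q_n$, where $q_k={\tt A}$ if all quasi-principal minors of order $k$ are nonzero, $q_k={\tt S}$ if some but not all are nonzero, and $q_k={\tt N}$ if all are zero. *)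

theory Defs
  imports "Jordan_Normal_Form.Determinant" "Jordan_Normal_Form.DL_Submatrix"
begin

text \<open>
  Matrices are those of \<^typ>\<open>'a mat\<close>, so the rows and columns of an \<open>n \<times> n\<close> matrix are indexed
  by \<open>{0..<n}\<close> instead of \<open>{1..n}\<close>; \<open>B[\<alpha>,\<beta>]\<close> is \<open>submatrix B \<alpha> \<beta>\<close>.
\<close>

definition quasi_principal_index :: "nat \<Rightarrow> nat set \<Rightarrow> nat set \<Rightarrow> bool" where
  "quasi_principal_index n \<alpha> \<beta> \<longleftrightarrow>
     \<alpha> \<subseteq> {0..<n} \<and> \<beta> \<subseteq> {0..<n} \<and> card \<alpha> = card \<beta> \<and>
     card \<alpha> - 1 \<le> card (\<alpha> \<inter> \<beta>) \<and> card (\<alpha> \<inter> \<beta>) \<le> card \<alpha>"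

definition quasi_principal_minors :: "'a :: comm_ring_1 mat \<Rightarrow> nat \<Rightarrow> 'a set" where
  "quasi_principal_minors B k =
     {det (submatrix B \<alpha> \<beta>) | \<alpha> \<beta>. quasi_principal_index (dim_row B) \<alpha> \<beta> \<and> card \<alpha> = k}"

datatype qpr_letter = qA | qS | qN

definition qpr_term :: "'a :: comm_ring_1 mat \<Rightarrow> nat \<Rightarrow> qpr_letter" where
  "qpr_term B k =
     (if \<forall>m \<in> quasi_principal_minors B k. m \<noteq> 0 then qA
      else if \<exists>m \<in> quasi_principal_minors B k. m \<noteq> 0 then qS
      else qN)"

text \<open>
  The list entry at position \<open>i\<close> of \<open>qpr B\<close> is the term \<open>q\<^sub>i\<^sub>+\<^sub>1\<close> of the sequence.
\<close>

definition qpr :: "'a :: comm_ring_1 mat \<Rightarrow> qpr_letter list" where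
  "qpr B = map (qpr_term B) [1..<dim_row B + 1]"

definition occurs_consecutively :: "'b \<Rightarrow> 'b \<Rightarrow> 'b list \<Rightarrow> bool" where
  "occurs_consecutively x y q \<longleftrightarrow> (\<exists>i. i + 1 < length q \<and> q ! i = x \<and> q ! (i + 1) = y)"

end

theory Submission
  imports Defs "HOL-Computational_Algebra.Polynomial"
begin

text \<open>
  Necessity: a quasi-principal minor of order \<open>k + 1\<close> with row set \<open>\<alpha>\<close> and column set \<open>\<beta>\<close>
  is expanded along a row \<open>i\<close> with \<open>\<alpha> - {i} \<subseteq> \<beta>\<close>; all the cofactors are then quasi-principal
  minors of order \<open>k\<close>, so \<open>N\<close> is inherited by the next term.

  Sufficiency: by induction on \<open>n\<close>, the matrix \<open>B\<close> is bordered to \<open>E\<^sup>T B E + t e e\<^sup>T\<close>, where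
  \<open>E = [I | x]\<close> and \<open>e\<close> is the last unit vector. Terms \<open>S\<close> persist by themselves. Taking \<open>t = 0\<close> keeps
  the rank, and otherwise the new matrix is nonsingular when \<open>B\<close> is. Taking \<open>x\<^sub>0 = 0\<close> turns
  \<open>q\<^sub>n = A\<close> into \<open>S\<close>. Every other choice is generic, so that a term \<open>A\<close> persists as soon as each
  new minor is nonzero for some \<open>(x, t)\<close> obeying these constraints. A unit vector \<open>x = e\<^sub>l\<close>
  replaces the new index by \<open>l\<close> in the minor and works except in one configuration, which is handled
  by \<open>x = e\<^sub>i + e\<^sub>j\<close>.
\<close>

section \<open>Minors along index lists and their vanishing\<close>

text \<open>With lists in arbitrary order instead of sets, replacing one index by another is a plain
  \<open>map\<close>. Reordering costs only a sign, and only vanishing matters later.\<close>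

definition minor :: "(nat \<Rightarrow> nat \<Rightarrow> 'a :: comm_ring_1) \<Rightarrow> nat list \<Rightarrow> nat list \<Rightarrow> 'a" where
  "minor A fs gs = det (mat (length fs) (length gs) (\<lambda>(a, b). A (fs ! a) (gs ! b)))"

definition quasi_principal_lists :: "nat \<Rightarrow> nat \<Rightarrow> nat list \<Rightarrow> nat list \<Rightarrow> bool" where
  "quasi_principal_lists n k fs gs \<longleftrightarrow>
     length fs = k \<and> length gs = k \<and> distinct fs \<and> distinct gs \<and>
     set fs \<subseteq> {..<n} \<and> set gs \<subseteq> {..<n} \<and> k - 1 \<le> card (set fs \<inter> set gs)"

lemma finite_quasi_principal_lists:
  "finite {(fs, gs). quasi_principal_lists n k fs gs}"
proof (rule finite_subset)
  let ?L = "{xs. set xs \<subseteq> {..<n} \<and> length xs = k}"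
  show "{(fs, gs). quasi_principal_lists n k fs gs} \<subseteq> ?L \<times> ?L"
    by (auto simp: quasi_principal_lists_def)
  show "finite (?L \<times> ?L)"
    by (intro finite_cartesian_product finite_lists_length_eq) auto
qed

lemma minor_transpose:
  assumes "length fs = length gs"
  shows "minor A fs gs = minor (\<lambda>i j. A j i) gs fs"
proof -
  let ?M = "mat (length fs) (length gs) (\<lambda>(a, b). A (fs ! a) (gs ! b))"
  have "transpose_mat ?M = mat (length gs) (length fs) (\<lambda>(a, b). A (fs ! b) (gs ! a))"
    by (rule eq_matI) auto
  moreover have "det (transpose_mat ?M) = det ?M"
    by (rule det_transpose[of _ "length fs"]) (use mat_carrier[of "length fs" "length gs"] assms in simp)
  ultimately show ?thesis by (simp add: minor_def)
qed

lemma minor_cong: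
  assumes "length fs = length fs'" "length gs = length gs'"
    and "\<And>a b. a < length fs \<Longrightarrow> b < length gs \<Longrightarrow> A (fs ! a) (gs ! b) = A' (fs' ! a) (gs' ! b)"
  shows "minor A fs gs = minor A' fs' gs'"
  unfolding minor_def using assms by (intro arg_cong[of _ _ det] eq_matI) auto

text \<open>Reordering rows multiplies the determinant by \<open>signof p\<close>, which is 1 or -1
  and so nonzero.\<close>

lemma minor_rows_eq_0_iff:
  fixes A :: "nat \<Rightarrow> nat \<Rightarrow> 'a :: idom"
  assumes "distinct fs" "distinct fs'" "set fs = set fs'" "length fs = length gs"
  shows "minor A fs gs = 0 \<longleftrightarrow> minor A fs' gs = 0"
proof -
  let ?k = "length gs"
  let ?M = "mat ?k ?k (\<lambda>(a, b). A (fs' ! a) (gs ! b))"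
  have "mset fs = mset fs'" using assms by (simp add: set_eq_iff_mset_eq_distinct)
  then obtain p where p: "p permutes {..<length fs'}" "permute_list p fs' = fs"
    by (rule mset_eq_permutation)
  have len: "length fs' = ?k"
    using assms distinct_card[of fs] distinct_card[of fs'] by simp
  have p': "p permutes {0..<?k}" using p(1) len by (simp add: atLeast0LessThan)
  have nth: "fs ! a = fs' ! p a" "p a < ?k" if "a < ?k" for a
    using permute_list_nth[OF p(1)] p len that permutes_in_image[OF p(1)] by auto
  have "det (mat ?k ?k (\<lambda>(i, j). ?M $$ (p i, j))) = signof p * det ?M"
    by (rule det_permute_rows[OF _ p']) simp
  moreover have "mat ?k ?k (\<lambda>(i, j). ?M $$ (p i, j))
      = mat (length fs) ?k (\<lambda>(a, b). A (fs ! a) (gs ! b))"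
    using nth assms(4) by (intro eq_matI) auto
  moreover have "signof p \<noteq> (0 :: 'a)" by (simp add: sign_def)
  ultimately show ?thesis by (simp add: minor_def len)
qed

lemma minor_eq_0_iff:
  fixes A :: "nat \<Rightarrow> nat \<Rightarrow> 'a :: idom"
  assumes "distinct fs" "distinct fs'" "set fs = set fs'" "length fs = length gs"
    and "distinct gs" "distinct gs'" "set gs = set gs'"
  shows "minor A fs gs = 0 \<longleftrightarrow> minor A fs' gs' = 0"
proof -
  have len: "length fs' = length gs" "length gs' = length gs"
    using assms distinct_card[of fs] distinct_card[of fs'] distinct_card[of gs] distinct_card[of gs']
    by simp_all
  have "minor A fs gs = 0 \<longleftrightarrow> minor (\<lambda>i j. A j i) gs fs' = 0"
    using minor_rows_eq_0_iff[OF assms(1-4), of A] minor_transpose[of fs' gs A] len by simp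
  also have "\<dots> \<longleftrightarrow> minor (\<lambda>i j. A j i) gs' fs' = 0"
    using minor_rows_eq_0_iff[of gs gs' fs'] assms len by simp
  finally show ?thesis using minor_transpose[of fs' gs' A] len by simp
qed

text \<open>Subtracting row \<open>i\<close> from row \<open>p\<close> leaves row \<open>j\<close>
  there and preserves the determinant.\<close>

lemma minor_subst_row:
  fixes A :: "nat \<Rightarrow> nat \<Rightarrow> 'a :: field"
  assumes A: "\<And>b. b \<in> set gs \<Longrightarrow> A p b = A i b + A j b"
    and "i \<in> set fs" "p \<in> set fs" "i \<noteq> p" "distinct fs" "length fs = length gs"
  shows "minor A fs gs = minor A (map (id(p := j)) fs) gs"
proof -
  let ?k = "length gs"
  let ?M = "mat ?k ?k (\<lambda>(a, b). A (fs ! a) (gs ! b))"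
  obtain a0 a1 where a: "a0 < ?k" "fs ! a0 = i" "a1 < ?k" "fs ! a1 = p"
    using assms by (metis in_set_conv_nth)
  have "det (addrow (-1) a1 a0 ?M) = det ?M"
    by (rule det_addrow[of _ ?k]) (use a assms in auto)
  moreover have "addrow (-1) a1 a0 ?M
      = mat ?k ?k (\<lambda>(x, b). A (map (id(p := j)) fs ! x) (gs ! b))"
    using a(1,3) assms(5,6) A[OF nth_mem] nth_eq_iff_index_eq[of fs _ a1]
    by (intro eq_matI) (auto simp: a(2,4))
  ultimately show ?thesis using assms(6) by (simp add: minor_def)
qed

lemma det_zero_column:
  fixes M :: "'a :: comm_ring_1 mat"
  assumes "M \<in> carrier_mat k k" "j < k" "\<And>i. i < k \<Longrightarrow> M $$ (i, j) = 0"
  shows "det M = 0"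
  using laplace_expansion_column[OF assms(1,2)] assms(3) by simp

text \<open>Serves twice: for the terms \<open>qN\<close>, and for the zero minor that turns a term
  \<open>qA\<close> into \<open>qS\<close>.\<close>

lemma minor_eq_0_if_factors:
  fixes A :: "nat \<Rightarrow> nat \<Rightarrow> 'a :: idom"
  assumes "finite L" "card L < length fs" "length gs = length fs"
    and A: "\<And>i j. i \<in> set fs \<Longrightarrow> j \<in> set gs \<Longrightarrow> A i j = (\<Sum>l\<in>L. U i l * V l j)"
  shows "minor A fs gs = 0"
proof -
  let ?k = "length fs" and ?r = "card L"
  obtain h where h: "bij_betw h {0..<?r} L"
    using ex_bij_betw_nat_finite[OF assms(1)] by blast
  \<comment> \<open>The left factor is padded with zero columns to a square matrix. Since
    \<open>?r < ?k\<close>, its last column is zero.\<close>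
  define P where "P = mat ?k ?k (\<lambda>(a, c). if c < ?r then U (fs ! a) (h c) else 0)"
  define Q where "Q = mat ?k ?k (\<lambda>(c, b). V (h c) (gs ! b))"
  have "mat ?k (length gs) (\<lambda>(a, b). A (fs ! a) (gs ! b)) = P * Q"
  proof (rule eq_matI)
    fix a b assume "a < dim_row (P * Q)" "b < dim_col (P * Q)"
    then have ab: "a < ?k" "b < ?k" by (auto simp: P_def Q_def)
    have "(P * Q) $$ (a, b) = (\<Sum>c\<in>{0..<?k}. if c < ?r then U (fs ! a) (h c) * V (h c) (gs ! b) else 0)"
      using ab by (simp add: P_def Q_def scalar_prod_def if_distrib[of "\<lambda>x. x * _"] cong: if_cong)
    also have "\<dots> = (\<Sum>c\<in>{0..<?r}. U (fs ! a) (h c) * V (h c) (gs ! b))"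
      using assms(2) by (intro sum.mono_neutral_cong_right) auto
    also have "\<dots> = (\<Sum>l\<in>L. U (fs ! a) l * V l (gs ! b))"
      by (rule sum.reindex_bij_betw[OF h])
    finally show "mat ?k (length gs) (\<lambda>(a, b). A (fs ! a) (gs ! b)) $$ (a, b) = (P * Q) $$ (a, b)"
      using ab assms(3) A by simp
  qed (auto simp: P_def Q_def assms)
  moreover have "det (P * Q) = det P * det Q"
    by (rule det_mult[of _ ?k]) (auto simp: P_def Q_def)
  moreover have "det P = 0"
    by (rule det_zero_column[of _ ?k "?k - 1"]) (use assms(2) in \<open>auto simp: P_def\<close>)
  ultimately show ?thesis by (simp add: minor_def)
qed

section \<open>Inheritance of vanishing by the next order\<close>

lemma quasi_principal_minors_vanish_Suc:
  fixes A :: "nat \<Rightarrow> nat \<Rightarrow> 'a :: comm_ring_1"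
  assumes zero: "\<And>fs gs. quasi_principal_lists n k fs gs \<Longrightarrow> minor A fs gs = 0"
    and qp: "quasi_principal_lists n (Suc k) fs gs"
  shows "minor A fs gs = 0"
proof -
  note qp = qp[unfolded quasi_principal_lists_def]
  have fin: "finite (set fs - set gs)" by simp
  have "card (set fs - set gs) \<le> 1"
    using qp card_Diff_subset_Int[of "set fs" "set gs"] distinct_card[of fs] by (simp; linarith)
  \<comment> \<open>At most one row index lies outside \<open>gs\<close>. The expansion uses that
    row, or row 0 if there is none.\<close>
  then obtain a where a: "a < Suc k" "set fs - {fs ! a} \<subseteq> set gs"
  proof (cases "set fs \<subseteq> set gs")
    case True
    then show ?thesis using that[of 0] by auto
  next
    case False
    then obtain i where i: "i \<in> set fs" "i \<notin> set gs" by auto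
    then have "set fs - set gs = {i}"
      using \<open>card (set fs - set gs) \<le> 1\<close> fin by (auto simp: card_le_Suc0_iff_eq)
    moreover obtain a where "a < Suc k" "fs ! a = i" using i(1) qp by (metis in_set_conv_nth)
    ultimately show ?thesis using that[of a] by auto
  qed
  define del where "del c xs = take c xs @ drop (Suc c) xs" for c and xs :: "nat list"
  have nth_del: "del c xs ! x = xs ! (if x < c then x else Suc x)"
    if "c < Suc k" "length xs = Suc k" "x < k" for c x xs
    using that by (auto simp: del_def nth_append min_def)
  have len_del: "length (del c xs) = k" if "c < Suc k" "length xs = Suc k" for c xs
    using that by (simp add: del_def)
  have set_del: "set (del c xs) = set xs - {xs ! c}" "distinct (del c xs)"
    if "c < Suc k" "length xs = Suc k" "distinct xs" for c xs
  proof -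
    have xs: "take c xs @ xs ! c # drop (Suc c) xs = xs"
      using that by (simp add: id_take_nth_drop[symmetric])
    have d: "distinct (take c xs @ xs ! c # drop (Suc c) xs)" unfolding xs by (rule that)
    have "set xs = set (take c xs @ xs ! c # drop (Suc c) xs)" unfolding xs ..
    then show "set (del c xs) = set xs - {xs ! c}" using d unfolding del_def by auto
    show "distinct (del c xs)" using d by (simp add: del_def)
  qed
  let ?M = "mat (Suc k) (Suc k) (\<lambda>(a, b). A (fs ! a) (gs ! b))"
  have "det (mat_delete ?M a b) = 0" if b: "b < Suc k" for b
  proof -
    have "mat_delete ?M a b = mat k k (\<lambda>(x, y). A (del a fs ! x) (del b gs ! y))"
      using qp a b by (intro eq_matI) (auto simp: mat_delete_def nth_del)
    then have "det (mat_delete ?M a b) = minor A (del a fs) (del b gs)"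
      using qp a b by (simp add: minor_def len_del)
    \<comment> \<open>By the choice of \<open>a\<close>, all \<open>k\<close> remaining rows lie in
      \<open>gs\<close>, so deleting the column \<open>gs ! b\<close> costs at most one common
      index.\<close>
    also have "quasi_principal_lists n k (del a fs) (del b gs)"
    proof -
      have "set (del a fs) \<inter> set (del b gs) = set (del a fs) - {gs ! b}"
        using qp a b by (auto simp: set_del)
      moreover have "card (set (del a fs)) = k"
        using qp a by (metis distinct_card len_del set_del(2))
      ultimately have "k - 1 \<le> card (set (del a fs) \<inter> set (del b gs))"
        by (simp add: card_Diff_singleton_if)
      then show ?thesis
        using qp a b by (auto simp: quasi_principal_lists_def set_del len_del)
    qed
    then have "minor A (del a fs) (del b gs) = 0" by (rule zero)
    finally show ?thesis .
  qed
  then have "det ?M = 0"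
    using laplace_expansion_row[of ?M "Suc k" a] a by (simp add: cofactor_def)
  then show ?thesis using qp by (simp add: minor_def)
qed

section \<open>From set-indexed submatrices to index lists\<close>

lemma submatrix_eq_minor:
  assumes B: "B \<in> carrier_mat n n" and qp: "quasi_principal_index n \<alpha> \<beta>"
  defines "fs \<equiv> map (pick \<alpha>) [0..<card \<alpha>]" and "gs \<equiv> map (pick \<beta>) [0..<card \<beta>]"
  shows "det (submatrix B \<alpha> \<beta>) = minor (\<lambda>i j. B $$ (i, j)) fs gs"
    and "quasi_principal_lists n (card \<alpha>) fs gs"
    and "set fs = \<alpha>" and "set gs = \<beta>"
proof -
  note qp = qp[unfolded quasi_principal_index_def]
  have eq: "{i. i < n \<and> i \<in> \<alpha>} = \<alpha>" "{i. i < n \<and> i \<in> \<beta>} = \<beta>" using qp by auto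
  have fin: "finite \<alpha>" "finite \<beta>" using qp finite_subset by blast+
  have inj: "inj_on (pick I) {0..<card I}" for I
  proof (rule inj_onI)
    fix x y assume "x \<in> {0..<card I}" "y \<in> {0..<card I}" "pick I x = pick I y"
    then show "x = y" using pick_mono_le[of x I y] pick_mono_le[of y I x] by (cases x y rule: linorder_cases) auto
  qed
  have im: "pick I ` {0..<card I} = I" if "finite I" for I
  proof (rule card_subset_eq[OF that])
    show "pick I ` {0..<card I} \<subseteq> I" using pick_in_set_le by auto
    show "card (pick I ` {0..<card I}) = card I" using card_image[OF inj] by simp
  qed
  show sets: "set fs = \<alpha>" "set gs = \<beta>" using im fin by (simp_all add: fs_def gs_def)
  have "distinct fs" "distinct gs" using inj by (simp_all add: fs_def gs_def distinct_map)
  then show "quasi_principal_lists n (card \<alpha>) fs gs"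
    using qp sets by (simp add: quasi_principal_lists_def) (auto simp: fs_def gs_def atLeast0LessThan)
  show "det (submatrix B \<alpha> \<beta>) = minor (\<lambda>i j. B $$ (i, j)) fs gs"
    unfolding minor_def submatrix_def using B eq
    by (intro arg_cong[of _ _ det] eq_matI) (auto simp: fs_def gs_def)
qed

lemma quasi_principal_index_set:
  assumes "quasi_principal_lists n k fs gs"
  shows "quasi_principal_index n (set fs) (set gs)" and "card (set fs) = k"
  using assms card_mono[of "set fs" "set fs \<inter> set gs"]
  by (auto simp: quasi_principal_lists_def quasi_principal_index_def distinct_card
      atLeast0LessThan)

text \<open>The Boolean \<open>z\<close> treats the existence of a zero minor and of a nonzero minor
  at once. Only vanishing is transferred, because a list in another order may flip the sign.\<close>

lemma quasi_principal_minors_zero_iff: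
  fixes B :: "'a :: idom mat"
  assumes B: "B \<in> carrier_mat n n"
  shows "(\<exists>m \<in> quasi_principal_minors B k. (m = 0) = z) \<longleftrightarrow>
    (\<exists>fs gs. quasi_principal_lists n k fs gs \<and> (minor (\<lambda>i j. B $$ (i, j)) fs gs = 0) = z)"
    (is "?l = ?r")
proof
  assume ?l
  then obtain \<alpha> \<beta> where qi: "quasi_principal_index n \<alpha> \<beta>" "card \<alpha> = k"
    and z: "(det (submatrix B \<alpha> \<beta>) = 0) = z"
    using B unfolding quasi_principal_minors_def by auto
  show ?r using submatrix_eq_minor(1,2)[OF B qi(1)] qi(2) z by metis
next
  assume ?r
  then obtain fs gs where qp: "quasi_principal_lists n k fs gs"
    and z: "(minor (\<lambda>i j. B $$ (i, j)) fs gs = 0) = z" by blast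
  note qi = quasi_principal_index_set[OF qp]
  note S = submatrix_eq_minor[OF B qi(1)]
  have "(det (submatrix B (set fs) (set gs)) = 0) = z"
    unfolding S(1) z[symmetric]
    using S(2-4) qp unfolding quasi_principal_lists_def by (intro minor_eq_0_iff) metis+
  moreover have "det (submatrix B (set fs) (set gs)) \<in> quasi_principal_minors B k"
    using qi B unfolding quasi_principal_minors_def by blast
  ultimately show ?l by blast
qed

section \<open>Generic choice of parameters\<close>

text \<open>Polynomial dependence is tested along affine lines only. This suffices for genericity
  and reduces it to univariate polynomials.\<close>

definition poly_on_lines :: "((nat \<Rightarrow> 'a :: comm_ring_1) \<Rightarrow> 'a) \<Rightarrow> bool" where
  "poly_on_lines \<phi> \<longleftrightarrow> (\<forall>x y. \<exists>p. \<forall>s. \<phi> (\<lambda>l. x l + s * (y l - x l)) = poly p s)"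

lemma poly_on_lines_const: "poly_on_lines (\<lambda>x. c)"
  unfolding poly_on_lines_def by (intro allI exI[of _ "[:c:]"]) simp

lemma poly_on_lines_coord: "poly_on_lines (\<lambda>x. x l)"
  unfolding poly_on_lines_def
proof (intro allI)
  fix x y :: "nat \<Rightarrow> 'a"
  show "\<exists>p. \<forall>s. x l + s * (y l - x l) = poly p s"
    by (rule exI[of _ "[:x l, y l - x l:]"]) simp
qed

lemma poly_on_lines_add:
  assumes "poly_on_lines \<phi>" "poly_on_lines \<psi>"
  shows "poly_on_lines (\<lambda>x. \<phi> x + \<psi> x)"
  using assms unfolding poly_on_lines_def by (metis poly_add)

lemma poly_on_lines_mult:
  assumes "poly_on_lines \<phi>" "poly_on_lines \<psi>"
  shows "poly_on_lines (\<lambda>x. \<phi> x * \<psi> x)"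
  using assms unfolding poly_on_lines_def by (metis poly_mult)

lemma poly_on_lines_sum:
  assumes "\<And>i. i \<in> I \<Longrightarrow> poly_on_lines (\<phi> i)"
  shows "poly_on_lines (\<lambda>x. \<Sum>i\<in>I. \<phi> i x)"
  using assms
  by (induction I rule: infinite_finite_induct)
    (auto intro: poly_on_lines_add poly_on_lines_const)

lemma poly_on_lines_prod:
  assumes "\<And>i. i \<in> I \<Longrightarrow> poly_on_lines (\<phi> i)"
  shows "poly_on_lines (\<lambda>x. \<Prod>i\<in>I. \<phi> i x)"
  using assms
  by (induction I rule: infinite_finite_induct)
    (auto intro: poly_on_lines_mult poly_on_lines_const)

text \<open>By the Leibniz formula, a minor is a sum of products of entries.\<close>

lemma poly_on_lines_minor:
  assumes "\<And>i j. poly_on_lines (\<lambda>x. A x i j)" and "length fs = length gs"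
  shows "poly_on_lines (\<lambda>x. minor (A x) fs gs)"
proof -
  let ?k = "length gs"
  have "minor (A x) fs gs = (\<Sum>p \<in> {p. p permutes {0..<?k}}.
      signof p * (\<Prod>i = 0..<?k. if i < ?k \<and> p i < ?k then A x (fs ! i) (gs ! p i) else 0))" for x
  proof -
    have "p i < ?k" if "p permutes {0..<?k}" "i < ?k" for p i
      using permutes_in_image[OF that(1), of i] that(2) by simp
    then show ?thesis
      unfolding minor_def using assms(2)
      by (subst det_def'[of _ ?k]) (auto intro!: sum.cong prod.cong)
  qed
  moreover have "poly_on_lines (\<lambda>x. if i < ?k \<and> p i < ?k then A x (fs ! i) (gs ! p i) else 0)"
    for i and p :: "nat \<Rightarrow> nat"
    using assms(1) poly_on_lines_const by (cases "i < ?k \<and> p i < ?k") auto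
  ultimately show ?thesis
    by (simp only:) (intro poly_on_lines_sum poly_on_lines_mult poly_on_lines_prod
      poly_on_lines_const)
qed

text \<open>
  On the line through a common nonzero point of \<open>\<Phi>\<close> and a nonzero point of \<open>\<phi>\<close>, each of the
  functions is a nonzero polynomial in one variable.
\<close>

lemma poly_on_lines_common_nonzero:
  fixes \<Phi> :: "((nat \<Rightarrow> 'a :: field_char_0) \<Rightarrow> 'a) set"
  assumes "finite \<Phi>"
    and "\<And>\<phi>. \<phi> \<in> \<Phi> \<Longrightarrow> poly_on_lines \<phi>"
    and "\<And>\<phi>. \<phi> \<in> \<Phi> \<Longrightarrow> \<exists>x. (\<forall>l\<in>Z. x l = 0) \<and> \<phi> x \<noteq> 0"
  shows "\<exists>x. (\<forall>l\<in>Z. x l = 0) \<and> (\<forall>\<phi>\<in>\<Phi>. \<phi> x \<noteq> 0)"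
  using assms
proof (induction \<Phi> rule: finite_induct)
  case empty
  show ?case by (rule exI[of _ "\<lambda>_. 0"]) simp
next
  case (insert \<phi> \<Phi>)
  then obtain x where x: "\<forall>l\<in>Z. x l = 0" "\<forall>\<psi>\<in>\<Phi>. \<psi> x \<noteq> 0" by auto
  from insert.prems obtain y where y: "\<forall>l\<in>Z. y l = 0" "\<phi> y \<noteq> 0" by blast
  \<comment> \<open>The line from \<open>x\<close> at \<open>s = 0\<close> to \<open>y\<close> at
    \<open>s = 1\<close>; the coordinates in \<open>Z\<close> vanish all along it.\<close>
  define w where "w s l = x l + s * (y l - x l)" for s l
  have "\<forall>\<psi>\<in>insert \<phi> \<Phi>. \<exists>p. \<forall>s. \<psi> (w s) = poly p s"
    using insert.prems(1) unfolding poly_on_lines_def w_def by blast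
  then obtain P where P: "\<And>\<psi> s. \<psi> \<in> insert \<phi> \<Phi> \<Longrightarrow> \<psi> (w s) = poly (P \<psi>) s"
    by (metis bchoice)
  have w01: "w 0 = x" "w 1 = y" by (auto simp: w_def)
  have "P \<psi> \<noteq> 0" if "\<psi> \<in> insert \<phi> \<Phi>" for \<psi>
  proof
    assume "P \<psi> = 0"
    then have "\<psi> x = 0" "\<psi> y = 0" using P[OF that, of 0] P[OF that, of 1] w01 by simp_all
    then show False using that x(2) y(2) by auto
  qed
  \<comment> \<open>Finitely many roots in total cannot exhaust a field of characteristic 0, which
    is infinite.\<close>
  then have "finite (\<Union>\<psi>\<in>insert \<phi> \<Phi>. {s. poly (P \<psi>) s = 0})"
    using insert.hyps(1) by (intro finite_UN_I) (auto simp: poly_roots_finite)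
  then obtain s where "s \<notin> (\<Union>\<psi>\<in>insert \<phi> \<Phi>. {s. poly (P \<psi>) s = 0})"
    using ex_new_if_finite[OF infinite_UNIV_char_0] by blast
  then have "\<forall>\<psi>\<in>insert \<phi> \<Phi>. \<psi> (w s) \<noteq> 0" using P by auto
  moreover have "\<forall>l\<in>Z. w s l = 0" using x(1) y(1) by (simp add: w_def)
  ultimately show ?case by blast
qed

section \<open>Bordering a symmetric matrix\<close>

text \<open>Entry \<open>l\<close> of column \<open>i\<close> of \<open>E = [I | x]\<close>.\<close>

definition border_row :: "nat \<Rightarrow> (nat \<Rightarrow> 'a :: comm_ring_1) \<Rightarrow> nat \<Rightarrow> nat \<Rightarrow> 'a" where
  "border_row n x i l = (if i < n then of_bool (i = l) else x l)"

text \<open>The entry \<open>x n\<close> of the parameter vector plays the role of \<open>t\<close>.\<close>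

definition bordered :: "(nat \<Rightarrow> nat \<Rightarrow> 'a :: comm_ring_1) \<Rightarrow> nat \<Rightarrow> (nat \<Rightarrow> 'a) \<Rightarrow> nat \<Rightarrow> nat \<Rightarrow> 'a" where
  "bordered B n x i j =
     (\<Sum>l<n. border_row n x i l * (\<Sum>m<n. B l m * border_row n x j m))
     + (if i < n \<or> j < n then 0 else x n)"

lemma bordered_row_lt:
  assumes "i < n"
  shows "bordered B n x i j = (\<Sum>m<n. B i m * border_row n x j m)"
  using assms by (simp add: bordered_def border_row_def of_bool_def if_distrib[of "\<lambda>y. y * _"] cong: if_cong)

lemma bordered_lt:
  assumes "i < n" "j < n"
  shows "bordered B n x i j = B i j"
  using assms bordered_row_lt[OF assms(1), of B x j]
  by (simp add: border_row_def of_bool_def if_distrib[of "\<lambda>y. _ * y"] cong: if_cong)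

lemma bordered_sym:
  assumes "\<And>i j. B i j = B j i"
  shows "bordered B n x i j = bordered B n x j i"
proof -
  have "(\<Sum>l<n. border_row n x i l * (\<Sum>m<n. B l m * border_row n x j m))
      = (\<Sum>l<n. \<Sum>m<n. border_row n x i l * B l m * border_row n x j m)"
    by (simp add: sum_distrib_left mult.assoc)
  also have "\<dots> = (\<Sum>m<n. \<Sum>l<n. border_row n x i l * B l m * border_row n x j m)"
    by (rule sum.swap)
  also have "\<dots> = (\<Sum>m<n. border_row n x j m * (\<Sum>l<n. B m l * border_row n x i l))"
    unfolding sum_distrib_left
    by (intro sum.cong refl) (simp add: assms ac_simps)
  finally show ?thesis by (auto simp: bordered_def)
qed

lemma poly_on_lines_bordered: "poly_on_lines (\<lambda>x. bordered B n x i j)"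
proof -
  have E: "poly_on_lines (\<lambda>x. border_row n x i l)" for i l
    by (cases "i < n") (simp_all add: border_row_def poly_on_lines_const poly_on_lines_coord)
  have "poly_on_lines (\<lambda>x. if i < n \<or> j < n then 0 else x n)"
    by (cases "i < n \<or> j < n") (auto simp: poly_on_lines_const poly_on_lines_coord)
  then show ?thesis unfolding bordered_def
    by (intro poly_on_lines_add poly_on_lines_sum poly_on_lines_mult poly_on_lines_const E)
qed

text \<open>The last column of \<open>E\<close> repeats column \<open>l\<close>, and
  \<open>t = 0\<close> because \<open>l < n\<close>. The new index \<open>n\<close> thus duplicates
  \<open>l\<close>.\<close>

lemma bordered_unit:
  assumes "l < n" "i \<le> n" "j \<le> n"
  shows "bordered B n (\<lambda>m. of_bool (m = l)) i j = B ((id(n := l)) i) ((id(n := l)) j)"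
proof -
  let ?x = "\<lambda>m. of_bool (m = l)"
  have E: "border_row n ?x i = border_row n ?x ((id(n := l)) i)" if "i \<le> n" for i
    using that assms(1) by (auto simp: border_row_def)
  have "bordered B n ?x i j = bordered B n ?x ((id(n := l)) i) ((id(n := l)) j)"
    using assms unfolding bordered_def E[OF assms(2)] E[OF assms(3)] by auto
  also have "\<dots> = B ((id(n := l)) i) ((id(n := l)) j)"
    using assms by (intro bordered_lt) auto
  finally show ?thesis .
qed

text \<open>Column \<open>n\<close> of \<open>E\<close> is the sum of columns \<open>i\<close> and
  \<open>j\<close>, and \<open>t = 0\<close> because both are below \<open>n\<close>.\<close>

lemma bordered_two_units:
  assumes "i < n" "j < n"
  shows "bordered B n (\<lambda>m. of_bool (m = i) + of_bool (m = j)) n b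
    = bordered B n (\<lambda>m. of_bool (m = i) + of_bool (m = j)) i b
      + bordered B n (\<lambda>m. of_bool (m = i) + of_bool (m = j)) j b"
proof -
  have E: "border_row n (\<lambda>m. of_bool (m = i) + of_bool (m = j)) n l
    = border_row n (\<lambda>m. of_bool (m = i) + of_bool (m = j)) i l
      + border_row n (\<lambda>m. of_bool (m = i) + of_bool (m = j)) j l" for l
    using assms by (auto simp: border_row_def)
  show ?thesis
    unfolding bordered_def E distrib_right sum.distrib using assms by simp
qed

lemma set_map_subst:
  "set (map (id(n := l)) fs) = (if n \<in> set fs then insert l (set fs - {n}) else set fs)"
  by auto

lemma distinct_map_subst:
  assumes "distinct fs" "n \<in> set fs \<longrightarrow> l \<notin> set fs"
  shows "distinct (map (id(n := l)) fs)"
  using assms by (auto simp: distinct_map inj_on_def)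

text \<open>Replacing \<open>n\<close> by \<open>l\<close> gives a minor of \<open>B\<close>. A list
  containing \<open>n\<close> does not contain \<open>l\<close>, so the lists stay distinct and the
  overlap does not shrink.\<close>

lemma bordered_minor_nonzero_unit:
  assumes nz: "\<And>fs gs. quasi_principal_lists n k fs gs \<Longrightarrow> minor B fs gs \<noteq> 0"
    and qp: "quasi_principal_lists (Suc n) k fs gs"
    and l: "l < n" "n \<in> set fs \<longrightarrow> l \<notin> set fs" "n \<in> set gs \<longrightarrow> l \<notin> set gs"
  shows "minor (bordered B n (\<lambda>m. of_bool (m = l))) fs gs \<noteq> 0"
proof -
  note qp = qp[unfolded quasi_principal_lists_def]
  let ?fs = "map (id(n := l)) fs" and ?gs = "map (id(n := l)) gs"
  have le: "i \<le> n" if "i \<in> set fs \<union> set gs" for i using that qp by auto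
  have "minor (bordered B n (\<lambda>m. of_bool (m = l))) fs gs = minor B ?fs ?gs"
  proof (rule minor_cong)
    fix a b assume "a < length fs" "b < length gs"
    then show "bordered B n (\<lambda>m. of_bool (m = l)) (fs ! a) (gs ! b) = B (?fs ! a) (?gs ! b)"
      using bordered_unit[OF l(1) le le, of "fs ! a" "gs ! b" B] by simp
  qed simp_all
  moreover have "quasi_principal_lists n k ?fs ?gs"
  proof -
    have "inj_on (id(n := l)) (set fs \<inter> set gs)" using l by (auto simp: inj_on_def)
    then have "card (set fs \<inter> set gs) = card (id(n := l) ` (set fs \<inter> set gs))"
      by (rule card_image[symmetric])
    also have "\<dots> \<le> card (set ?fs \<inter> set ?gs)" by (intro card_mono) auto
    finally have "k - 1 \<le> card (set ?fs \<inter> set ?gs)" using qp by linarith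
    moreover have "set ?fs \<subseteq> {..<n}" "set ?gs \<subseteq> {..<n}"
      using qp l(1) by (auto simp: less_Suc_eq)
    ultimately show ?thesis
      using qp l distinct_map_subst[of fs n l] distinct_map_subst[of gs n l]
      unfolding quasi_principal_lists_def length_map by blast
  qed
  ultimately show ?thesis using nz by simp
qed

text \<open>The exceptional configuration. Row \<open>n\<close> is row \<open>i\<close> plus row
  \<open>j\<close>, so subtracting row \<open>i\<close> turns it into row \<open>j\<close>; likewise
  column \<open>n\<close> becomes column \<open>i\<close>. Both index sets are then
  \<open>(set fs \<union> set gs) - {n}\<close>, so up to sign this is a principal minor of
  \<open>B\<close>.\<close>

lemma bordered_minor_nonzero_two_units:
  fixes B :: "nat \<Rightarrow> nat \<Rightarrow> 'a :: field"
  assumes nz: "\<And>fs gs. quasi_principal_lists n k fs gs \<Longrightarrow> minor B fs gs \<noteq> 0"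
    and sym: "\<And>i j. B i j = B j i"
    and qp: "quasi_principal_lists (Suc n) k fs gs"
    and n: "n \<in> set fs" "n \<in> set gs"
    and i: "i \<in> set fs" "i \<notin> set gs" and j: "j \<in> set gs" "j \<notin> set fs"
  shows "minor (bordered B n (\<lambda>m. of_bool (m = i) + of_bool (m = j))) fs gs \<noteq> 0"
proof -
  note qp = qp[unfolded quasi_principal_lists_def]
  define A where "A = bordered B n (\<lambda>m. of_bool (m = i) + of_bool (m = j))"
  have ij: "i < n" "j < n" using qp n i j by (auto simp: less_Suc_eq)
  have row: "A n b = A i b + A j b" for b
    unfolding A_def using bordered_two_units[OF ij] .
  have Asym: "(\<lambda>i j. A j i) = A" unfolding A_def using bordered_sym[of B, OF sym] by blast
  let ?fs = "map (id(n := j)) fs" and ?gs = "map (id(n := i)) gs"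
  have "minor A fs gs = minor A ?fs gs"
    by (rule minor_subst_row[of _ _ _ i]) (use row qp n i ij in auto)
  \<comment> \<open>Transposing the symmetric matrix lets the row lemma act on columns.\<close>
  also have "\<dots> = minor A gs ?fs"
    using minor_transpose[of ?fs gs A] qp Asym by simp
  also have "\<dots> = minor A ?gs ?fs"
    by (rule minor_subst_row[of _ _ _ j]) (use row[unfolded add.commute[of "A i _"]] qp n j ij in auto)
  also have "\<dots> = minor A ?fs ?gs"
    using minor_transpose[of ?fs ?gs A] qp Asym by simp
  also have "\<dots> = minor B ?fs ?gs"
  proof (rule minor_cong)
    fix a b assume ab: "a < length ?fs" "b < length ?gs"
    have "?fs ! a \<in> set ?fs" "?gs ! b \<in> set ?gs" using ab nth_mem by blast+
    moreover have "set ?fs \<subseteq> {..<n}" "set ?gs \<subseteq> {..<n}"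
      using qp ij by (auto simp: less_Suc_eq)
    ultimately have "?fs ! a < n" "?gs ! b < n" by blast+
    then show "A (?fs ! a) (?gs ! b) = B (?fs ! a) (?gs ! b)"
      unfolding A_def by (rule bordered_lt)
  qed simp_all
  finally have "minor A fs gs = minor B ?fs ?gs" .
  moreover have "quasi_principal_lists n k ?fs ?gs"
  proof -
    \<comment> \<open>The overlap loses \<open>n\<close> but gains \<open>i\<close>.\<close>
    have "card (set fs \<inter> set gs) = card (insert i (set fs \<inter> set gs - {n}))"
      using n i card_Suc_Diff1[of "set fs \<inter> set gs" n] by simp
    also have "\<dots> \<le> card (set ?fs \<inter> set ?gs)"
      using n i j ij by (intro card_mono) (auto simp: set_map_subst simp del: set_map)
    finally have "k - 1 \<le> card (set ?fs \<inter> set ?gs)" using qp by linarith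
    moreover have "set ?fs \<subseteq> {..<n}" "set ?gs \<subseteq> {..<n}"
      using qp ij by (auto simp: less_Suc_eq)
    ultimately show ?thesis
      using qp i j distinct_map_subst[of fs n j] distinct_map_subst[of gs n i]
      unfolding quasi_principal_lists_def length_map by blast
  qed
  ultimately show ?thesis using nz unfolding A_def by simp
qed

text \<open>\<open>Z\<close> holds the coordinates forced to vanish: 0 to create a term
  \<open>qS\<close>, \<open>n\<close> to keep the rank. If every admissible unit vector is blocked,
  counting shows that both lists contain \<open>n\<close> and differ, which is the two-unit
  configuration.\<close>

lemma ex_bordered_minor_nonzero:
  fixes B :: "nat \<Rightarrow> nat \<Rightarrow> 'a :: field"
  assumes nz: "\<And>fs gs. quasi_principal_lists n k fs gs \<Longrightarrow> minor B fs gs \<noteq> 0"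
    and sym: "\<And>i j. B i j = B j i"
    and qp: "quasi_principal_lists (Suc n) k fs gs"
    and k: "1 \<le> k" "k \<le> n" and Z: "Z \<subseteq> {0, n}" "0 \<in> Z \<Longrightarrow> k < n"
  shows "\<exists>x. (\<forall>l\<in>Z. x l = 0) \<and> minor (bordered B n x) fs gs \<noteq> 0"
proof (cases "\<exists>l<n. l \<notin> Z \<and> (n \<in> set fs \<longrightarrow> l \<notin> set fs) \<and> (n \<in> set gs \<longrightarrow> l \<notin> set gs)")
  case True
  then obtain l where l: "l < n" "l \<notin> Z" "n \<in> set fs \<longrightarrow> l \<notin> set fs" "n \<in> set gs \<longrightarrow> l \<notin> set gs"
    by blast
  show ?thesis
    by (rule exI[of _ "\<lambda>m. of_bool (m = l)"])
      (use bordered_minor_nonzero_unit[OF nz qp l(1,3,4)] l(2) in auto)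
next
  case False
  note qp' = qp[unfolded quasi_principal_lists_def]
  have card: "card (set fs) = k" "card (set gs) = k" using qp' by (auto simp: distinct_card)
  \<comment> \<open>If coordinate 0 is frozen, \<open>k < n\<close> makes up for the lost
    index.\<close>
  have "k \<le> card ({..<n} - Z)"
  proof (cases "0 \<in> Z")
    case True
    have "{1..<n} \<subseteq> {..<n} - Z" using Z(1) by auto
    then have "card {1..<n} \<le> card ({..<n} - Z)" by (intro card_mono) auto
    then show ?thesis using Z(2)[OF True] by simp
  next
    case False
    then have "{..<n} - Z = {..<n}" using Z(1) by auto
    then show ?thesis using k by simp
  qed
  \<comment> \<open>A list of length \<open>k\<close> containing \<open>n\<close> blocks only
    \<open>k - 1\<close> indices below \<open>n\<close>, fewer than the free ones.\<close>
  then have nsub: "\<not> {..<n} - Z \<subseteq> H - {n}" if "n \<in> H" "card H = k" "finite H" for H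
    using card_mono[of "H - {n}" "{..<n} - Z"] that k by auto
  have "{..<n} - Z \<noteq> {}" using \<open>k \<le> card ({..<n} - Z)\<close> k(1) by (intro notI) simp
  then have nonempty: "\<exists>l<n. l \<notin> Z" by auto
  have n: "n \<in> set fs" "n \<in> set gs"
  proof -
    have "n \<in> set gs \<and> {..<n} - Z \<subseteq> set gs - {n}" if "n \<notin> set fs"
      using False nonempty that by auto
    then show "n \<in> set fs" using nsub[of "set gs"] card by auto
    have "n \<in> set fs \<and> {..<n} - Z \<subseteq> set fs - {n}" if "n \<notin> set gs"
      using False nonempty that by auto
    then show "n \<in> set gs" using nsub[of "set fs"] card by auto
  qed
  have sub: "{..<n} - Z \<subseteq> (set fs \<union> set gs) - {n}" using False n by auto
  have ne: "set fs \<noteq> set gs" using nsub[OF n(1) card(1)] sub by auto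
  obtain i where i: "i \<in> set fs" "i \<notin> set gs"
    using ne card card_subset_eq[of "set gs" "set fs"] by auto
  obtain j where j: "j \<in> set gs" "j \<notin> set fs"
    using ne card card_subset_eq[of "set fs" "set gs"] by auto
  \<comment> \<open>The union has at most \<open>k + 1\<close> elements, one of them
    \<open>n\<close>. It therefore covers exactly the free indices, and \<open>i\<close> and
    \<open>j\<close> are free.\<close>
  have "card ((set fs \<union> set gs) - {n}) \<le> card ({..<n} - Z)"
    using card_Un_Int[of "set fs" "set gs"] card qp' n \<open>k \<le> card ({..<n} - Z)\<close> by auto
  then have "{..<n} - Z = (set fs \<union> set gs) - {n}"
    using sub by (intro card_seteq) auto
  then have "i \<notin> Z" "j \<notin> Z" using i j n by auto
  then show ?thesis
    by (intro exI[of _ "\<lambda>m. of_bool (m = i) + of_bool (m = j)"])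
      (use bordered_minor_nonzero_two_units[OF nz sym qp n i j] in auto)
qed

text \<open>This parameter vector means a zero border and \<open>t = 1\<close>, so the bordered
  matrix is block diagonal with blocks \<open>B\<close> and 1.\<close>

lemma bordered_full_minor_nonzero:
  fixes B :: "nat \<Rightarrow> nat \<Rightarrow> 'a :: field"
  assumes nz: "minor B [0..<n] [0..<n] \<noteq> 0"
    and qp: "quasi_principal_lists (Suc n) (Suc n) fs gs"
  shows "minor (bordered B n (\<lambda>m. of_bool (m = n))) fs gs \<noteq> 0"
proof -
  note qp = qp[unfolded quasi_principal_lists_def]
  define A where "A = bordered B n (\<lambda>m. of_bool (m = n))"
  let ?M = "mat (Suc n) (Suc n) (\<lambda>(a, b). A a b)"
  have sets: "set fs = set [0..<Suc n]" "set gs = set [0..<Suc n]"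
    using qp card_subset_eq[of "{..<Suc n}"] distinct_card by (metis atLeast_upt card_lessThan finite_lessThan)+
  have "A n b = of_bool (b = n)" if "b \<le> n" for b
    unfolding A_def bordered_def using that by (simp add: border_row_def)
  then have "det ?M = cofactor ?M n n"
    using laplace_expansion_row[of ?M "Suc n" n] by (simp add: lessThan_Suc)
  also have "\<dots> = det (mat_delete ?M n n)" by (simp add: cofactor_def flip: mult_2)
  also have "mat_delete ?M n n = mat n n (\<lambda>(a, b). B a b)"
    by (rule eq_matI) (auto simp: mat_delete_def A_def bordered_lt)
  also have "det \<dots> = minor B [0..<n] [0..<n]"
    unfolding minor_def by (intro arg_cong[of _ _ det] eq_matI) auto
  finally have "det ?M \<noteq> 0" using nz by simp
  also have "det ?M = minor A [0..<Suc n] [0..<Suc n]"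
    unfolding minor_def by (intro arg_cong[of _ _ det] eq_matI) (auto simp del: upt_Suc)
  finally have "minor A [0..<Suc n] [0..<Suc n] \<noteq> 0" .
  moreover have "minor A fs gs = 0 \<longleftrightarrow> minor A [0..<Suc n] [0..<Suc n] = 0"
    by (rule minor_eq_0_iff) (use qp sets in \<open>simp_all del: upt_Suc\<close>)
  ultimately show ?thesis unfolding A_def by blast
qed

section \<open>Rank factorizations and the inductive construction\<close>

text \<open>Over a field: the leading \<open>n\<close> by \<open>n\<close> block has rank at most
  \<open>r\<close>.\<close>

definition factors_through :: "(nat \<Rightarrow> nat \<Rightarrow> 'a :: comm_ring_1) \<Rightarrow> nat \<Rightarrow> nat \<Rightarrow> bool" where
  "factors_through A n r \<longleftrightarrow> (\<exists>U V. \<forall>i<n. \<forall>j<n. A i j = (\<Sum>l<r. U i l * V l j))"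

text \<open>For \<open>t = 0\<close>, a factorization \<open>B = U V\<close> yields
  \<open>E^T B E = (E^T U) (V E)\<close>.\<close>

lemma factors_through_bordered:
  assumes "factors_through B n r" "x n = 0"
  shows "factors_through (bordered B n x) (Suc n) r"
proof -
  obtain U V where UV: "\<And>i j. i < n \<Longrightarrow> j < n \<Longrightarrow> B i j = (\<Sum>c<r. U i c * V c j)"
    using assms(1) unfolding factors_through_def by blast
  let ?U = "\<lambda>i c. \<Sum>l<n. border_row n x i l * U l c"
  let ?V = "\<lambda>c j. \<Sum>m<n. V c m * border_row n x j m"
  have "bordered B n x i j = (\<Sum>c<r. ?U i c * ?V c j)" for i j
  proof -
    have "bordered B n x i j
        = (\<Sum>l<n. border_row n x i l * (\<Sum>m<n. (\<Sum>c<r. U l c * V c m) * border_row n x j m))"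
      using assms(2) UV by (simp add: bordered_def)
    also have "\<dots> = (\<Sum>l<n. border_row n x i l * (\<Sum>c<r. U l c * ?V c j))"
      unfolding sum_distrib_left sum_distrib_right
      by (subst sum.swap[of _ "{..<r}"]) (simp add: mult.assoc)
    also have "\<dots> = (\<Sum>c<r. ?U i c * ?V c j)"
      unfolding sum_distrib_left[of "border_row _ _ _ _"] sum_distrib_right
      by (subst sum.swap) (simp add: mult.assoc)
    finally show ?thesis .
  qed
  then show ?thesis
    unfolding factors_through_def by (intro exI[of _ ?U] exI[of _ ?V]) simp
qed

text \<open>
  Bordering makes the new minors combinations of arbitrary, not only quasi-principal, minors of
  the same order; hence a term \<open>N\<close> is recorded by a rank factorization.
\<close>

definition realizes :: "(nat \<Rightarrow> nat \<Rightarrow> 'a :: field) \<Rightarrow> nat \<Rightarrow> (nat \<Rightarrow> qpr_letter) \<Rightarrow> bool" where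
  "realizes A n q \<longleftrightarrow> (\<forall>i j. A i j = A j i) \<and> (\<forall>k\<in>{1..n}.
     (q k = qA \<longrightarrow> (\<forall>fs gs. quasi_principal_lists n k fs gs \<longrightarrow> minor A fs gs \<noteq> 0)) \<and>
     (q k = qS \<longrightarrow> (\<exists>fs gs. quasi_principal_lists n k fs gs \<and> minor A fs gs \<noteq> 0) \<and>
                   (\<exists>fs gs. quasi_principal_lists n k fs gs \<and> minor A fs gs = 0)) \<and>
     (q k = qN \<longrightarrow> factors_through A n (k - 1)))"

lemma quasi_principal_lists_upt:
  assumes "k \<le> n"
  shows "quasi_principal_lists n k [0..<k] [0..<k]"
  using assms by (auto simp: quasi_principal_lists_def)

text \<open>One bordering keeps the earlier terms, except that the last may drop from
  \<open>qA\<close> to \<open>qS\<close>. Terms \<open>qN\<close> are kept by \<open>t = 0\<close>,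
  which makes the new matrix singular, so they must be absent when \<open>qA\<close> is
  appended.\<close>

lemma realizes_Suc:
  fixes B :: "nat \<Rightarrow> nat \<Rightarrow> 'a :: field_char_0"
  assumes R: "realizes B n q"
    and q': "\<And>k. k \<in> {1..n} \<Longrightarrow> q' k = q k \<or> k = n \<and> q k = qA \<and> q' k = qS"
    and last: "q' (Suc n) \<noteq> qS"
    and A: "q' (Suc n) = qA \<Longrightarrow> n > 0 \<Longrightarrow> q n = qA"
    and N: "\<And>k. q' (Suc n) = qA \<Longrightarrow> k \<in> {1..n} \<Longrightarrow> q' k \<noteq> qN"
  shows "\<exists>B' :: nat \<Rightarrow> nat \<Rightarrow> 'a. realizes B' (Suc n) q'"
proof -
  have sym: "\<And>i j. B i j = B j i" using R by (simp add: realizes_def)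
  have RA: "minor B fs gs \<noteq> 0" if "k \<in> {1..n}" "q k = qA" "quasi_principal_lists n k fs gs" for k fs gs
    using R that unfolding realizes_def by blast
  \<comment> \<open>Coordinate 0 belongs to the border only if \<open>0 < n\<close>; for
    \<open>n = 0\<close> it is already \<open>t\<close>.\<close>
  define Z where "Z = (if 0 < n \<and> q' n = qS then {0} else {}) \<union> (if q' (Suc n) = qN then {n} else {})"
  define I where "I = (\<Union>k\<in>{k \<in> {1..Suc n}. q' k = qA}. {(fs, gs). quasi_principal_lists (Suc n) k fs gs})"
  define \<Phi> where "\<Phi> = (\<lambda>(fs, gs) x. minor (bordered B n x) fs gs) ` I"
  have "\<exists>x. (\<forall>l\<in>Z. x l = 0) \<and> (\<forall>\<phi>\<in>\<Phi>. \<phi> x \<noteq> 0)"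
  proof (rule poly_on_lines_common_nonzero)
    show "finite \<Phi>" unfolding \<Phi>_def I_def
      by (intro finite_imageI finite_UN_I finite_quasi_principal_lists) simp
  next
    fix \<phi> assume "\<phi> \<in> \<Phi>"
    then obtain k fs gs where k: "k \<in> {1..Suc n}" "q' k = qA"
      and qp: "quasi_principal_lists (Suc n) k fs gs"
      and \<phi>: "\<phi> = (\<lambda>x. minor (bordered B n x) fs gs)"
      unfolding \<Phi>_def I_def by auto
    show "poly_on_lines \<phi>"
      unfolding \<phi> using qp
      by (intro poly_on_lines_minor poly_on_lines_bordered) (simp add: quasi_principal_lists_def)
    show "\<exists>x. (\<forall>l\<in>Z. x l = 0) \<and> \<phi> x \<noteq> 0"
    proof (cases "k = Suc n")
      case True
      \<comment> \<open>The witness has \<open>t = 1\<close>, which \<open>Z\<close> permits since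
        the new term is \<open>qA\<close>. For \<open>n = 0\<close> the empty minor is 1.\<close>
      have "minor B [0..<n] [0..<n] \<noteq> 0"
      proof (cases "n = 0")
        case True
        then show ?thesis by (simp add: minor_def)
      next
        case False
        then show ?thesis
          using RA[of n] A k True quasi_principal_lists_upt[of n n] by simp
      qed
      then have "\<phi> (\<lambda>m. of_bool (m = n)) \<noteq> 0"
        unfolding \<phi> using bordered_full_minor_nonzero qp True by blast
      moreover have "\<forall>l\<in>Z. of_bool (l = n) = (0 :: 'a)"
        using k True by (auto simp: Z_def split: if_splits)
      ultimately show ?thesis by (intro exI[of _ "\<lambda>m. of_bool (m = n)"]) simp
    next
      case False
      then have k': "k \<in> {1..n}" using k by auto
      have qk: "q k = qA" using q'[OF k'] k by auto
      \<comment> \<open>Coordinate 0 is frozen only if \<open>q' n\<close> is \<open>qS\<close>,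
        whereas \<open>q' k\<close> is \<open>qA\<close>.\<close>
      have "0 \<in> Z \<Longrightarrow> k < n" using k k' by (cases "k = n") (auto simp: Z_def split: if_splits)
      then show ?thesis
        unfolding \<phi> using k'
        by (intro ex_bordered_minor_nonzero[OF RA[OF k' qk] sym qp])
          (auto simp: Z_def split: if_splits)
    qed
  qed
  then obtain x where x: "\<And>l. l \<in> Z \<Longrightarrow> x l = 0" and nz: "\<And>\<phi>. \<phi> \<in> \<Phi> \<Longrightarrow> \<phi> x \<noteq> 0" by blast
  let ?B = "bordered B n x"
  have old: "quasi_principal_lists (Suc n) k fs gs \<and> minor ?B fs gs = minor B fs gs"
    if qp: "quasi_principal_lists n k fs gs" for k fs gs
  proof
    show "quasi_principal_lists (Suc n) k fs gs"
      using qp by (auto simp: quasi_principal_lists_def)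
    have "fs ! a < n" "gs ! b < n" if "a < length fs" "b < length gs" for a b
      using qp that nth_mem[of a fs] nth_mem[of b gs] unfolding quasi_principal_lists_def by blast+
    then show "minor ?B fs gs = minor B fs gs"
      by (intro minor_cong bordered_lt) auto
  qed
  have "realizes ?B (Suc n) q'"
    unfolding realizes_def
  proof (intro conjI ballI impI allI)
    show "?B i j = ?B j i" for i j by (rule bordered_sym[OF sym])
  next
    fix k fs gs assume "k \<in> {1..Suc n}" "q' k = qA" "quasi_principal_lists (Suc n) k fs gs"
    then show "minor ?B fs gs \<noteq> 0" using nz[of "\<lambda>x. minor (bordered B n x) fs gs"]
      unfolding \<Phi>_def I_def by (auto simp: image_iff)
  next
    fix k assume k: "k \<in> {1..Suc n}" "q' k = qS"
    then have k': "k \<in> {1..n}" using last by (cases "k = Suc n") auto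
    show "\<exists>fs gs. quasi_principal_lists (Suc n) k fs gs \<and> minor ?B fs gs \<noteq> 0"
    proof (cases "q k = qS")
      case True
      then obtain fs gs where "quasi_principal_lists n k fs gs" "minor B fs gs \<noteq> 0"
        using R k' unfolding realizes_def by blast
      then show ?thesis using old[of k fs gs] by metis
    next
      case False
      then have "q k = qA" using q'[OF k'] k by auto
      moreover have qp: "quasi_principal_lists n k [0..<k] [0..<k]"
        using k' by (intro quasi_principal_lists_upt) simp
      ultimately have "minor B [0..<k] [0..<k] \<noteq> 0" using RA k' by blast
      then show ?thesis using old[OF qp] by metis
    qed
    show "\<exists>fs gs. quasi_principal_lists (Suc n) k fs gs \<and> minor ?B fs gs = 0"
    proof (cases "q k = qS")
      case True
      then obtain fs gs where "quasi_principal_lists n k fs gs" "minor B fs gs = 0"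
        using R k' unfolding realizes_def by blast
      then show ?thesis using old[of k fs gs] by metis
    next
      case False
      then have kn: "k = n" using q'[OF k'] k by auto
      then have "n > 0" using k' by auto
      then have x0: "x 0 = 0" using kn k by (intro x) (simp add: Z_def)
      \<comment> \<open>Since \<open>x 0 = 0\<close>, columns 1 to \<open>n\<close> of
        \<open>E\<close> all have entry 0 at position 0. This almost-principal block of order
        \<open>n\<close> thus factors through \<open>n - 1\<close> dimensions.\<close>
      have "{0..<n} \<inter> {1..<Suc n} = {1..<n}" by auto
      then have "quasi_principal_lists (Suc n) n [0..<n] [1..<Suc n]"
        by (auto simp: quasi_principal_lists_def simp del: upt_Suc)
      moreover have "minor ?B [0..<n] [1..<Suc n] = 0"
      proof (rule minor_eq_0_if_factors)
        show "finite {1..<n}" "card {1..<n} < length [0..<n]" "length [1..<Suc n] = length [0..<n]"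
          using \<open>n > 0\<close> by simp_all
        fix i j assume ij: "i \<in> set [0..<n]" "j \<in> set [1..<Suc n]"
        then have "?B i j = (\<Sum>m<n. B i m * border_row n x j m)"
          by (intro bordered_row_lt) simp
        also have "\<dots> = (\<Sum>m\<in>{1..<n}. B i m * border_row n x j m)"
          using ij x0 by (intro sum.mono_neutral_right) (auto simp: border_row_def Suc_le_eq)
        finally show "?B i j = (\<Sum>m\<in>{1..<n}. B i m * border_row n x j m)" .
      qed
      ultimately show ?thesis using kn by blast
    qed
  next
    fix k assume k: "k \<in> {1..Suc n}" "q' k = qN"
    \<comment> \<open>Any term \<open>qN\<close> excludes a new \<open>qA\<close>, and a final
      \<open>qS\<close> is excluded anyway; hence \<open>t = 0\<close>.\<close>
    have qN: "q' (Suc n) = qN"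
    proof (cases "k = Suc n")
      case False
      then have "q' (Suc n) \<noteq> qA" using N[of k] k by auto
      then show ?thesis using last by (cases "q' (Suc n)") auto
    qed (use k in simp)
    then have xn: "x n = 0" by (intro x) (simp add: Z_def)
    show "factors_through ?B (Suc n) (k - 1)"
    proof (cases "k = Suc n")
      case True
      \<comment> \<open>The product \<open>E^T (B E)\<close> has inner dimension \<open>n\<close>,
        one less than the order of the new matrix.\<close>
      have "?B i j = (\<Sum>l<n. border_row n x i l * (\<Sum>m<n. B l m * border_row n x j m))" for i j
        using xn by (simp add: bordered_def)
      then show ?thesis unfolding factors_through_def using True
        by (intro exI[of _ "border_row n x"] exI[of _ "\<lambda>l j. \<Sum>m<n. B l m * border_row n x j m"]) simp
    next
      case False
      then have k': "k \<in> {1..n}" using k by auto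
      then have "q k = qN" using q'[OF k'] k by auto
      then have "factors_through B n (k - 1)" using R k' unfolding realizes_def by blast
      then show ?thesis using xn by (rule factors_through_bordered)
    qed
  qed
  then show ?thesis by blast
qed

lemma ex_realizes:
  assumes "n > 0 \<Longrightarrow> q n \<noteq> qS" and "\<And>k. 1 \<le> k \<Longrightarrow> k < n \<Longrightarrow> q k = qN \<Longrightarrow> q (Suc k) = qN"
  shows "\<exists>B :: nat \<Rightarrow> nat \<Rightarrow> 'a :: field_char_0. realizes B n q"
  using assms
proof (induction n arbitrary: q)
  case 0
  show ?case by (rule exI[of _ "\<lambda>_ _. 0"]) (simp add: realizes_def)
next
  case (Suc n)
  have N_stays: "q m = qN" if "k \<le> m" "m \<le> Suc n" "1 \<le> k" "q k = qN" for k m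
    using that(1,2)
  proof (induction m rule: dec_induct)
    case (step m)
    then show ?case using Suc.prems(2)[of m] that(3) by simp
  qed (rule that)
  \<comment> \<open>The induction hypothesis does not allow a final \<open>qS\<close>, so it is
    raised to \<open>qA\<close> here and lowered again by the bordering.\<close>
  define q0 where "q0 = (if q n = qN then q else q(n := qA))"
  have "\<exists>B :: nat \<Rightarrow> nat \<Rightarrow> 'a. realizes B n q0"
  proof (rule Suc.IH)
    show "q0 n \<noteq> qS" by (simp add: q0_def)
    show "q0 (Suc k) = qN" if "1 \<le> k" "k < n" "q0 k = qN" for k
    proof -
      have "q k = qN" using that by (simp add: q0_def split: if_splits)
      then have "q (Suc k) = qN" using that Suc.prems(2)[of k] by simp
      then show ?thesis using that by (auto simp: q0_def)
    qed
  qed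
  then obtain B :: "nat \<Rightarrow> nat \<Rightarrow> 'a" where R: "realizes B n q0" by blast
  show ?case
  proof (rule realizes_Suc[OF R])
    show "q k = q0 k \<or> k = n \<and> q0 k = qA \<and> q k = qS" for k
      by (cases "q k") (auto simp: q0_def)
    show "q (Suc n) \<noteq> qS" using Suc.prems(1) by simp
    show "q k \<noteq> qN" if "q (Suc n) = qA" "k \<in> {1..n}" for k
      using that N_stays[of k "Suc n"] by auto
    then show "q0 n = qA" if "q (Suc n) = qA" "n > 0"
      using that by (auto simp: q0_def)
  qed
qed

section \<open>Reading the terms of \<open>qpr\<close> off the minors\<close>

lemma qpr_term_eq_qA_iff:
  fixes B :: "'a :: field mat"
  assumes "B \<in> carrier_mat n n"
  shows "qpr_term B k = qA \<longleftrightarrow>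
    (\<forall>fs gs. quasi_principal_lists n k fs gs \<longrightarrow> minor (\<lambda>i j. B $$ (i, j)) fs gs \<noteq> 0)"
  using quasi_principal_minors_zero_iff[OF assms, of k True]
  by (auto simp: qpr_term_def)

text \<open>For \<open>k > n\<close> there are no minors and \<open>qpr_term\<close> defaults to
  \<open>qA\<close>, hence the bound on \<open>k\<close>. The leading principal minor then separates
  \<open>qN\<close> from \<open>qA\<close>.\<close>

lemma qpr_term_eq_qN_iff:
  fixes B :: "'a :: field mat"
  assumes "B \<in> carrier_mat n n" "k \<le> n"
  shows "qpr_term B k = qN \<longleftrightarrow>
    (\<forall>fs gs. quasi_principal_lists n k fs gs \<longrightarrow> minor (\<lambda>i j. B $$ (i, j)) fs gs = 0)"
  using quasi_principal_minors_zero_iff[OF assms(1), of k True]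
    quasi_principal_minors_zero_iff[OF assms(1), of k False]
    quasi_principal_lists_upt[OF assms(2)]
  by (auto simp: qpr_term_def)

lemma qpr_term_realizes:
  assumes R: "realizes A n q" and k: "k \<in> {1..n}"
  shows "qpr_term (mat n n (\<lambda>(i, j). A i j)) k = q k"
proof -
  let ?B = "mat n n (\<lambda>(i, j). A i j)"
  have B: "?B \<in> carrier_mat n n" by simp
  have eq: "minor (\<lambda>i j. ?B $$ (i, j)) fs gs = minor A fs gs"
    if qp: "quasi_principal_lists n k fs gs" for fs gs
  proof (rule minor_cong)
    fix a b assume "a < length fs" "b < length gs"
    then have "fs ! a < n" "gs ! b < n"
      using qp nth_mem[of a fs] nth_mem[of b gs] unfolding quasi_principal_lists_def by blast+
    then show "?B $$ (fs ! a, gs ! b) = A (fs ! a) (gs ! b)" by simp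
  qed simp_all
  have Aiff: "qpr_term ?B k = qA \<longleftrightarrow> (\<forall>fs gs. quasi_principal_lists n k fs gs \<longrightarrow> minor A fs gs \<noteq> 0)"
    using qpr_term_eq_qA_iff[OF B, of k] eq by auto
  have Niff: "qpr_term ?B k = qN \<longleftrightarrow> (\<forall>fs gs. quasi_principal_lists n k fs gs \<longrightarrow> minor A fs gs = 0)"
    using qpr_term_eq_qN_iff[OF B, of k] k eq by auto
  show ?thesis
  proof (cases "q k")
    case qA
    then show ?thesis using R k Aiff unfolding realizes_def by simp
  next
    case qS
    then have "qpr_term ?B k \<noteq> qA" "qpr_term ?B k \<noteq> qN"
      using R k Aiff Niff unfolding realizes_def by blast+
    then show ?thesis using qS by (cases "qpr_term ?B k") auto
  next
    case qN
    then obtain U V where UV: "\<And>i j. i < n \<Longrightarrow> j < n \<Longrightarrow> A i j = (\<Sum>l<k - 1. U i l * V l j)"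
      using R k unfolding realizes_def factors_through_def by blast
    have "minor A fs gs = 0" if "quasi_principal_lists n k fs gs" for fs gs
    proof (rule minor_eq_0_if_factors)
      show "finite {..<k - 1}" "card {..<k - 1} < length fs" "length gs = length fs"
        using that k by (auto simp: quasi_principal_lists_def)
      fix i j assume "i \<in> set fs" "j \<in> set gs"
      then show "A i j = (\<Sum>l\<in>{..<k - 1}. U i l * V l j)"
        using that UV unfolding quasi_principal_lists_def by blast
    qed
    then show ?thesis using Niff qN by simp
  qed
qed

text \<open>Order \<open>n\<close> admits a single minor, so zero and nonzero minors cannot both
  occur.\<close>

lemma qpr_term_full_order:
  assumes "B \<in> carrier_mat n n"
  shows "qpr_term B n \<noteq> qS"
proof -
  have full: "\<alpha> = {0..<n} \<and> \<beta> = {0..<n}" if "quasi_principal_index n \<alpha> \<beta>" "card \<alpha> = n" for \<alpha> \<beta>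
  proof -
    have full: "I = {0..<n}" if "I \<subseteq> {0..<n}" "card I = n" for I
      using that by (intro card_subset_eq) simp_all
    have "\<alpha> \<subseteq> {0..<n}" "\<beta> \<subseteq> {0..<n}" "card \<beta> = n"
      using that unfolding quasi_principal_index_def by metis+
    then show ?thesis using full that(2) by blast
  qed
  have "m = det (submatrix B {0..<n} {0..<n})" if m: "m \<in> quasi_principal_minors B n" for m
  proof -
    obtain \<alpha> \<beta> where "quasi_principal_index n \<alpha> \<beta>" "card \<alpha> = n" "m = det (submatrix B \<alpha> \<beta>)"
      using m assms unfolding quasi_principal_minors_def by auto
    then show ?thesis using full[of \<alpha> \<beta>] by metis
  qed
  then show ?thesis unfolding qpr_term_def by (metis qpr_letter.distinct(1,5))
qed

lemma qpr_term_qN_Suc: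
  fixes B :: "'a :: field mat"
  assumes "B \<in> carrier_mat n n" "Suc k \<le> n" "qpr_term B k = qN"
  shows "qpr_term B (Suc k) = qN"
proof -
  have "minor (\<lambda>i j. B $$ (i, j)) fs gs = 0" if "quasi_principal_lists n k fs gs" for fs gs
    using assms(3) that qpr_term_eq_qN_iff[OF assms(1) Suc_leD[OF assms(2)]] by simp
  then show ?thesis
    using qpr_term_eq_qN_iff[OF assms(1,2)] quasi_principal_minors_vanish_Suc by metis
qed

theorem theorem3p7:
  fixes n :: nat and q :: "qpr_letter list"
  assumes "n \<ge> 1" and "length q = n"
  shows "(\<exists>B :: 'a :: field_char_0 mat. B \<in> carrier_mat n n \<and> transpose_mat B = B \<and> qpr B = q)
    \<longleftrightarrow> q ! (n - 1) \<noteq> qS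
        \<and> \<not> occurs_consecutively qN qA q \<and> \<not> occurs_consecutively qN qS q"
proof -
  have nth: "qpr B ! i = qpr_term B (Suc i)" if "B \<in> carrier_mat n n" "i < n" for B :: "'a mat" and i
    using that by (simp add: qpr_def del: upt_Suc)
  \<comment> \<open>With only three letters, condition (ii) says that \<open>qN\<close> is followed
    by \<open>qN\<close> alone.\<close>
  have letter: "q ! Suc i = qN \<longleftrightarrow> q ! Suc i \<noteq> qA \<and> q ! Suc i \<noteq> qS" for i
    by (cases "q ! Suc i") simp_all
  have occ: "\<not> occurs_consecutively qN qA q \<and> \<not> occurs_consecutively qN qS q
      \<longleftrightarrow> (\<forall>i. Suc i < n \<longrightarrow> q ! i = qN \<longrightarrow> q ! Suc i = qN)"
    unfolding occurs_consecutively_def assms(2) letter by auto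
  show ?thesis unfolding occ
  proof
    assume "\<exists>B :: 'a mat. B \<in> carrier_mat n n \<and> transpose_mat B = B \<and> qpr B = q"
    then obtain B :: "'a mat" where B: "B \<in> carrier_mat n n" and q: "qpr B = q" by blast
    have "q ! (n - 1) \<noteq> qS"
      using nth[OF B, of "n - 1"] qpr_term_full_order[OF B] assms(1) unfolding q by simp
    moreover have "q ! Suc i = qN" if "Suc i < n" "q ! i = qN" for i
      using nth[OF B, of i] nth[OF B, of "Suc i"] qpr_term_qN_Suc[OF B, of "Suc i"] that
      unfolding q by simp
    ultimately show "q ! (n - 1) \<noteq> qS \<and> (\<forall>i. Suc i < n \<longrightarrow> q ! i = qN \<longrightarrow> q ! Suc i = qN)" by blast
  next
    assume H: "q ! (n - 1) \<noteq> qS \<and> (\<forall>i. Suc i < n \<longrightarrow> q ! i = qN \<longrightarrow> q ! Suc i = qN)"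
    \<comment> \<open>List positions start at 0, so the term of order \<open>k\<close> is
      \<open>q ! (k - 1)\<close>.\<close>
    have "\<exists>A :: nat \<Rightarrow> nat \<Rightarrow> 'a. realizes A n (\<lambda>k. q ! (k - 1))"
    proof (rule ex_realizes)
      show "q ! (Suc k - 1) = qN" if "1 \<le> k" "k < n" "q ! (k - 1) = qN" for k
        using H that by (cases k) auto
    qed (use H in simp)
    then obtain A :: "nat \<Rightarrow> nat \<Rightarrow> 'a" where R: "realizes A n (\<lambda>k. q ! (k - 1))" by blast
    define B where "B = mat n n (\<lambda>(i, j). A i j)"
    have B: "B \<in> carrier_mat n n" by (simp add: B_def)
    have "qpr B = q"
    proof (rule nth_equalityI)
      show len: "length (qpr B) = length q" using B assms(2) by (simp add: qpr_def)
      fix i assume "i < length (qpr B)"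
      then have i: "i < n" using len assms(2) by simp
      then show "qpr B ! i = q ! i"
        using nth[OF B i] qpr_term_realizes[OF R, of "Suc i"] by (simp add: B_def)
    qed
    moreover have "transpose_mat B = B"
      using R by (intro eq_matI) (auto simp: B_def realizes_def)
    ultimately show "\<exists>B :: 'a mat. B \<in> carrier_mat n n \<and> transpose_mat B = B \<and> qpr B = q"
      using B by blast
  qed
qed

end
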